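(* Let $p\geq 5$ be an odd prime with $p \equiv 3 \pmod{4}$ and $r = (p-1)/2$. Exactly one of the following holds: (A) $-1 \notin \langle 2 \rangle$ in $(\mathbb{Z}/r\mathbb{Z})^{\times}$: then $2p$ lies in no $S_k$, $k\ge 0$. (B) $-1 \in \langle 2 \rangle$ and the least positive $t_0$ with $2^{t_0}\equiv -1 \pmod r$ is odd: then $2p$ lies in infinitely many $S_k$, but is never flanked by $14$ at distance $1$. (C) $-1 \in \langle 2 \rangle$ and the least positive $t_0$ with $2^{t_0}\equiv -1 \pmod r$ is even: then $2p$ lies in infinitely many $S_k$ and is flanked by $14$ at distance $1$ at every occurrence (i.e., for every $k$ with $2p\in S_k$ we have $k\ge 1$, $14\in S_{k-1}$ and $14\in S_{k+1}$). In the case that $r$ is prime, case (C) occurs if and only if $4 \mid \operatorname{ord}_r(2)$.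
   Context: For integers $k\ge 0$ and $n\ge 1$, $\sigma_k(n)=\sum_{d\mid n} d^k$ and $\phi(n)$ is Euler's totient function. For each $k\geq 0$, $S_k$ denotes the set of composite positive integers $n$ satisfying $n\cdot\sigma_k(n)\equiv 2 \pmod{\phi(n)}$. For $k\ge 1$, $14$ flanks $n$ at distance $1$ at $k$ if $n\in S_k$, $14\in S_{k-1}$ and $14\in S_{k+1}$. $\operatorname{ord}_r(2)$ is the multiplicative order of $2$ modulo $r$, and $\langle 2\rangle$ is the subgroup of $(\mathbb{Z}/r\mathbb{Z})^\times$ generated by $2$. *)

theory Defs
  imports "HOL-Number_Theory.Number_Theory" "HOL-Algebra.Generated_Groups"
begin

definition divisor_sigma :: "nat \<Rightarrow> nat \<Rightarrow> nat" where
  "divisor_sigma k n = (\<Sum>d | d dvd n. d ^ k)"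

definition S :: "nat \<Rightarrow> nat set" where
  "S k = {n. n > 1 \<and> \<not> prime n \<and> [n * divisor_sigma k n = 2] (mod totient n)}"

definition flanked_by_14 :: "nat \<Rightarrow> nat \<Rightarrow> bool" where
  "flanked_by_14 n k \<longleftrightarrow> k \<ge> 1 \<and> n \<in> S k \<and> 14 \<in> S (k - 1) \<and> 14 \<in> S (k + 1)"

text \<open>The subgroup of the unit group of the integers modulo \<open>r\<close> generated by 2, for odd \<open>r > 1\<close>.\<close>

definition span_two :: "nat \<Rightarrow> int set" where
  "span_two r = generate (units_of (residue_ring (int r))) {2 mod int r}"

definition neg_one_in_span_two :: "nat \<Rightarrow> bool" where
  "neg_one_in_span_two r \<longleftrightarrow>
     \<ominus>\<^bsub>residue_ring (int r)\<^esub> \<one>\<^bsub>residue_ring (int r)\<^esub> \<in> span_two r"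

text \<open>Only meaningful when some positive power of 2 is congruent to \<open>-1\<close> modulo \<open>r\<close>; it is
  used below only in conjunction with \<^const>\<open>neg_one_in_span_two\<close>.\<close>

definition least_exp :: "nat \<Rightarrow> nat" where
  "least_exp r = (LEAST t. t > 0 \<and> [2 ^ t = - 1] (mod int r))"

definition case_A :: "nat \<Rightarrow> bool" where
  "case_A r \<longleftrightarrow> \<not> neg_one_in_span_two r"

definition case_B :: "nat \<Rightarrow> bool" where
  "case_B r \<longleftrightarrow> neg_one_in_span_two r \<and> odd (least_exp r)"

definition case_C :: "nat \<Rightarrow> bool" where
  "case_C r \<longleftrightarrow> neg_one_in_span_two r \<and> even (least_exp r)"

end

theory Submission
  imports Defs
begin

text \<open>
  Since \<open>p \<equiv> 1\<close> modulo \<open>\<phi>(2p) = p - 1 = 2r\<close>, the condition \<open>2p \<in> S\<^sub>k\<close> reads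
  \<open>4 (1 + 2\<^sup>k) \<equiv> 2\<close> modulo \<open>2r\<close>, that is, \<open>2\<^bsup>k+1\<^esup> \<equiv> -1\<close> modulo \<open>r\<close>. For \<open>p = 7\<close> this says
  that \<open>k\<close> is even. If \<open>2\<^sup>m \<equiv> -1\<close> modulo \<open>r\<close> with \<open>r > 2\<close>, then \<open>ord\<^sub>r(2)\<close> divides \<open>2m\<close> but not
  \<open>m\<close>, so \<open>m\<close> is even exactly when \<open>4\<close> divides \<open>ord\<^sub>r(2)\<close>. Hence all such exponents \<open>m\<close> have
  the parity of the least one, which decides whether the flanking indices \<open>k - 1\<close> and \<open>k + 1\<close>
  are even.
\<close>

lemma divisors_two_times_prime:
  fixes p :: nat
  assumes "prime p"
  shows "{d. d dvd 2 * p} = {1, 2, p, 2 * p}"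
proof -
  have "d \<in> {1, 2, p, 2 * p}" if "d dvd 2 * p" for d
  proof -
    obtain a b where ab: "d = a * b" "a dvd 2" "b dvd p"
      using \<open>d dvd 2 * p\<close> division_decomp by blast
    have "a = 1 \<or> a = 2" "b = 1 \<or> b = p"
      using ab assms two_is_prime_nat by (auto simp: prime_nat_iff)
    then show ?thesis
      using ab by auto
  qed
  then show ?thesis
    by auto
qed

lemma divisor_sigma_two_times_prime:
  assumes "prime p" "odd p"
  shows "divisor_sigma k (2 * p) = (1 + 2 ^ k) * (1 + p ^ k)"
proof -
  have "p > 1" "p \<noteq> 2"
    using assms prime_gt_1_nat by auto
  then show ?thesis
    unfolding divisor_sigma_def divisors_two_times_prime[OF assms(1)]
    by (simp add: power_mult_distrib algebra_simps)
qed

lemma totient_two_times_prime: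
  assumes "prime p" "odd p"
  shows "totient (2 * p) = p - 1"
  using assms by (simp add: totient_mult_coprime totient_prime)

lemma two_times_prime_in_S_iff:
  assumes "prime p" "odd p"
  shows "2 * p \<in> S k \<longleftrightarrow> [2 ^ (k + 1) = - 1] (mod int ((p - 1) div 2))"
proof -
  define r where "r = (p - 1) div 2"
  have p: "p = 2 * r + 1"
    using assms(2) prime_gt_1_nat[OF assms(1)] unfolding r_def by (auto elim!: oddE)
  have "\<not> prime (2 * p)"
    using prime_product[of 2 p] prime_gt_1_nat[OF assms(1)] by auto
  then have "2 * p \<in> S k \<longleftrightarrow> [2 * p * ((1 + 2 ^ k) * (1 + p ^ k)) = 2] (mod (2 * r))"
    using prime_gt_1_nat[OF assms(1)] arg_cong[OF p, of "\<lambda>x. x - 1"]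
    by (simp add: S_def divisor_sigma_two_times_prime[OF assms] totient_two_times_prime[OF assms])
  also have "\<dots> \<longleftrightarrow> [2 * (2 * (1 + 2 ^ k)) = 2 * 1] (mod (2 * r))"
  proof -
    have p1: "[p = 1] (mod (2 * r))"
      unfolding p cong_def by (rule mod_add_self1)
    have "[2 * p * ((1 + 2 ^ k) * (1 + p ^ k)) = 2 * 1 * ((1 + 2 ^ k) * (1 + 1 ^ k))] (mod (2 * r))"
      by (intro cong_mult cong_add cong_pow cong_refl p1)
    moreover have "2 * 1 * ((1 + 2 ^ k) * (1 + 1 ^ k)) = 2 * (2 * (1 + 2 ^ k :: nat))"
      by simp
    ultimately have "[2 * p * ((1 + 2 ^ k) * (1 + p ^ k)) = 2 * (2 * (1 + 2 ^ k))] (mod (2 * r))"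
      by (simp only:)
    then show ?thesis
      by (simp only: cong_def mult_1_right)
  qed
  \<comment> \<open>The common factor 2 is cancelled from both sides and from the modulus, since
    \<open>2 * x mod (2 * r)\<close> is \<open>2 * (x mod r)\<close>.\<close>
  also have "\<dots> \<longleftrightarrow> [2 * (1 + 2 ^ k) = 1] (mod r)"
    unfolding cong_def mult_mod_right[of 2 _ r, symmetric] mult_cancel1 by simp
  also have "\<dots> \<longleftrightarrow> [int (2 * (1 + 2 ^ k)) = int 1] (mod int r)"
    by (simp only: cong_int_iff)
  \<comment> \<open>Both congruences say that \<open>r\<close> divides
    \<open>2 ^ (k + 1) + 1\<close>. Passing to integers is what allows \<open>- 1\<close> to be
    written.\<close>
  also have "\<dots> \<longleftrightarrow> [2 ^ (k + 1) = - 1] (mod int r)"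
    by (simp add: cong_iff_dvd_diff algebra_simps)
  finally show ?thesis
    unfolding r_def .
qed

lemma fourteen_in_S_iff: "14 \<in> S k \<longleftrightarrow> even k"
proof -
  have "[2 ^ m = - 1] (mod (3::int)) \<longleftrightarrow> odd m" for m :: nat
  proof -
    have "[2 ^ m = (- 1) ^ m] (mod (3::int))"
      by (intro cong_pow) (simp add: cong_def)
    then show ?thesis
      by (cases "even m") (auto simp: cong_def)
  qed
  from this[of "k + 1"] show ?thesis
    using two_times_prime_in_S_iff[of 7 k] by simp
qed

lemma ord_two_dvd_iff: "ord r 2 dvd n \<longleftrightarrow> [2 ^ n = 1] (mod int r)"
  unfolding ord_divides[symmetric] using cong_int_iff[of "2 ^ n" 1 r] by simp

lemma even_exponent_neg_one_iff_4_dvd_ord: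
  fixes r m :: nat
  assumes "r > 2" and m: "[2 ^ m = - 1] (mod int r)"
  shows "even m \<longleftrightarrow> 4 dvd ord r 2"
proof -
  define d where "d = ord r 2"
  have ord: "d dvd n \<longleftrightarrow> [2 ^ n = 1] (mod int r)" for n
    unfolding d_def by (rule ord_two_dvd_iff)
  have "\<not> d dvd m"
  proof
    assume "d dvd m"
    then have "[1 = - 1] (mod int r)"
      using m ord cong_sym cong_trans by blast
    then have "int r dvd 2"
      by (simp add: cong_iff_dvd_diff)
    then show False
      using \<open>r > 2\<close> by (auto dest: zdvd_imp_le)
  qed
  have "[(2 ^ m) ^ 2 = (- 1) ^ 2] (mod int r)"
    using m by (rule cong_pow)
  then have "d dvd m * 2"
    by (simp add: ord power_mult)
  \<comment> \<open>An odd \<open>d\<close> would be coprime to 2, so \<open>d dvd m * 2\<close>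
    would force \<open>d dvd m\<close>.\<close>
  have "even d"
    using \<open>\<not> d dvd m\<close> \<open>d dvd m * 2\<close> coprime_dvd_mult_left_iff[of d 2 m] by auto
  then obtain e where e: "d = 2 * e"
    by blast
  have "e dvd m"
    using \<open>d dvd m * 2\<close> e by simp
  \<comment> \<open>If \<open>e\<close> were odd, the coprime numbers 2 and \<open>e\<close> would
    both divide \<open>m\<close>, and so would their product \<open>d\<close>.\<close>
  moreover have "even e" if "even m"
    using that \<open>e dvd m\<close> \<open>\<not> d dvd m\<close> e divides_mult[of 2 m e] by auto
  ultimately have "even m \<longleftrightarrow> even e"
    by auto
  also have "\<dots> \<longleftrightarrow> 4 dvd d"
    using dvd_mult_cancel_left[of 2 2 e] by (simp add: e)
  finally show ?thesis
    unfolding d_def .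
qed

text \<open>Modulo a prime the only square roots of 1 are 1 and -1. The power of 2 at half the order
  is a square root of 1 other than 1.\<close>

lemma exists_power_two_eq_neg_one_mod_prime:
  fixes r :: nat
  assumes "prime r" "r > 2" "even (ord r 2)"
  shows "\<exists>t>0. [2 ^ t = - 1] (mod int r)"
proof -
  obtain e where e: "ord r 2 = 2 * e"
    using assms(3) by blast
  have "odd r"
    using assms prime_odd_nat by blast
  \<comment> \<open>\<open>ord r 2\<close> is 0 by convention when 2 and \<open>r\<close> are not
    coprime; oddness of \<open>r\<close> excludes this.\<close>
  then have "e > 0"
    using e by (cases "e = 0") (auto simp: ord_eq_0)
  have "\<not> [2 ^ e = 1] (mod int r)"
    using \<open>e > 0\<close> by (auto simp: ord_two_dvd_iff[symmetric] e dest: dvd_imp_le)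
  moreover have "[2 ^ e * 2 ^ e = 1] (mod int r)"
    using ord_two_dvd_iff[of r "e + e"] e by (simp add: power_add mult_2)
  then have "int r dvd (2 ^ e - 1) * (2 ^ e + 1)"
    by (simp add: cong_iff_dvd_diff algebra_simps)
  ultimately have "int r dvd 2 ^ e + 1"
    using assms(1) by (simp add: cong_iff_dvd_diff prime_dvd_mult_iff)
  then show ?thesis
    using \<open>e > 0\<close> by (auto simp: cong_iff_dvd_diff)
qed

text \<open>The unit group is finite, so the subgroup generated by 2 consists of the powers with
  natural exponents; inverses add nothing.\<close>

lemma neg_one_in_span_two_iff:
  assumes "odd r" "r > 1"
  shows "neg_one_in_span_two r \<longleftrightarrow> (\<exists>t>0. [2 ^ t = - 1] (mod int r))"
proof -
  define R where "R = residue_ring (int r)"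
  interpret residues "int r" R
    using assms by unfold_locales (auto simp: R_def)
  interpret U: group "units_of R"
    by (rule units_group)
  have two: "2 mod int r \<in> Units R"
    using assms by (intro mod_in_res_units) auto
  have pow: "(2 mod int r) [^]\<^bsub>units_of R\<^esub> (n::nat) = 2 ^ n mod int r" for n
  proof -
    have "(2 mod int r) [^]\<^bsub>units_of R\<^esub> n = (2 mod int r) [^]\<^bsub>R\<^esub> n"
      by (simp add: nat_pow_def units_of_def)
    then show ?thesis
      by (simp add: pow_cong)
  qed
  have "span_two r = {2 ^ n mod int r |n. True}"
    using U.generate_pow_on_finite_carrier[of "2 mod int r"] two
    by (simp add: span_two_def units_of_carrier pow flip: R_def)
  moreover have "\<ominus>\<^bsub>R\<^esub> \<one>\<^bsub>R\<^esub> = - 1 mod int r"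
    by (simp add: res_neg_eq res_one_eq)
  ultimately have "neg_one_in_span_two r \<longleftrightarrow> (\<exists>t. [2 ^ t = - 1] (mod int r))"
    by (auto simp: neg_one_in_span_two_def cong_def simp flip: R_def intro: sym)
  \<comment> \<open>Exponent 0 would give 1 congruent to -1, hence \<open>r\<close> dividing
    2.\<close>
  moreover have "t > 0" if "[2 ^ t = - 1] (mod int r)" for t
  proof (rule ccontr)
    assume "\<not> t > 0"
    then have "int r dvd 2"
      using that by (simp add: cong_iff_dvd_diff)
    then have "r \<le> 2"
      by (auto dest: zdvd_imp_le)
    then show False
      using assms by presburger
  qed
  ultimately show ?thesis
    by blast
qed

lemma least_exp_works:
  assumes "\<exists>t>0. [2 ^ t = - 1] (mod int r)"
  shows "least_exp r > 0" "[2 ^ least_exp r = - 1] (mod int r)"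
  using LeastI_ex[OF assms] unfolding least_exp_def by auto

text \<open>Odd multiples of \<open>t\<close> work as exponents too, because odd powers of -1 are
  -1.\<close>

lemma infinite_exponents_neg_one:
  fixes a m :: int
  assumes "t > 0" "[a ^ t = - 1] (mod m)"
  shows "infinite {k. [a ^ (k + 1) = - 1] (mod m)}"
proof -
  \<comment> \<open>The shift by 1 matches the exponent \<open>k + 1\<close>; the natural
    subtraction is exact because \<open>t > 0\<close>.\<close>
  define f where "f j = t * (2 * j + 1) - 1" for j :: nat
  have f: "f j + 1 = t * (2 * j + 1)" for j
    using \<open>t > 0\<close> unfolding f_def by simp
  have "inj f"
  proof (rule injI)
    fix i j
    assume "f i = f j"
    then have "t * (2 * i + 1) = t * (2 * j + 1)"
      by (metis f)
    then show "i = j"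
      using \<open>t > 0\<close> by simp
  qed
  have "[a ^ (f j + 1) = - 1] (mod m)" for j
    using cong_pow[OF assms(2), of "2 * j + 1"] unfolding f power_mult by simp
  then have "range f \<subseteq> {k. [a ^ (k + 1) = - 1] (mod m)}"
    by auto
  then show ?thesis
    using \<open>inj f\<close> finite_subset range_inj_infinite by blast
qed

theorem theorem4p5:
  fixes p r :: nat
  assumes "prime p" and "odd p" and "p \<ge> 5" and "[p = 3] (mod 4)"
    and "r = (p - 1) div 2"
  shows "(case_A r \<or> case_B r \<or> case_C r) \<and>
         \<not> (case_A r \<and> case_B r) \<and> \<not> (case_A r \<and> case_C r) \<and> \<not> (case_B r \<and> case_C r) \<and>
         (case_A r \<longrightarrow> (\<forall>k. 2 * p \<notin> S k)) \<and>
         (case_B r \<longrightarrow> infinite {k. 2 * p \<in> S k} \<and> (\<forall>k. \<not> flanked_by_14 (2 * p) k)) \<and>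
         (case_C r \<longrightarrow> infinite {k. 2 * p \<in> S k} \<and>
                       (\<forall>k. 2 * p \<in> S k \<longrightarrow> flanked_by_14 (2 * p) k)) \<and>
         (prime r \<longrightarrow> (case_C r \<longleftrightarrow> 4 dvd ord r 2))"
proof -
  have "p mod 4 = 3"
    using assms(4) by (simp add: cong_def)
  \<comment> \<open>The residue 3 modulo 4 excludes \<open>p = 5\<close> and \<open>p = 6\<close>,
    so \<open>p\<close> is at least 7 and \<open>r\<close> at least 3.\<close>
  then have "odd r" "r > 2"
    using assms(3,5) by presburger+
  then have span: "neg_one_in_span_two r \<longleftrightarrow> (\<exists>t>0. [2 ^ t = - 1] (mod int r))"
    by (intro neg_one_in_span_two_iff) auto
  have inS: "2 * p \<in> S k \<longleftrightarrow> [2 ^ (k + 1) = - 1] (mod int r)" for k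
    using two_times_prime_in_S_iff assms by simp
  have even_least: "even (least_exp r) \<longleftrightarrow> 4 dvd ord r 2" if "neg_one_in_span_two r"
    using that \<open>r > 2\<close> span least_exp_works(2) even_exponent_neg_one_iff_4_dvd_ord by blast
  have parity: "odd k \<longleftrightarrow> 4 dvd ord r 2" if "2 * p \<in> S k" for k
    using that \<open>r > 2\<close> even_exponent_neg_one_iff_4_dvd_ord[of r "k + 1"] by (simp add: inS)
  have inf: "infinite {k. 2 * p \<in> S k}" if "neg_one_in_span_two r"
    using that infinite_exponents_neg_one unfolding inS span by blast
  \<comment> \<open>At \<open>k = 0\<close>, where \<open>k - 1\<close> truncates, both sides are
    false: an occurrence there would have even index, so 4 would not divide the order.\<close>
  have flanked: "flanked_by_14 (2 * p) k \<longleftrightarrow> 2 * p \<in> S k \<and> 4 dvd ord r 2" for k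
    using parity[of k] by (cases k) (auto simp: flanked_by_14_def fourteen_in_S_iff)
  have "2 * p \<notin> S k" if "\<not> neg_one_in_span_two r" for k
    using that unfolding inS span by force
  \<comment> \<open>Needed for the last claim: divisibility by 4 alone must already yield the
    membership required in \<open>case_C\<close>.\<close>
  moreover have "neg_one_in_span_two r" if "prime r" "4 dvd ord r 2"
  proof -
    have "even (ord r 2)"
      using that(2) by (rule dvd_trans[rotated]) simp
    then show ?thesis
      using that(1) \<open>r > 2\<close> span exists_power_two_eq_neg_one_mod_prime by blast
  qed
  ultimately show ?thesis
    using even_least inf flanked unfolding case_A_def case_B_def case_C_def by blast
qed

end
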